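(* Let $W_1$ and $W_2$ be the specializations of $W=\tau_1XY+\tau_2YX+\tau_3X+\tau_4Y+\tau_0\mathcal{I}$ at $\tau_4=0,\ \tau_2=-q\tau_1$ and at $\tau_4=0,\ \tau_2=-q^{-1}\tau_1$, respectively. Then $$W_1=B_1(x)T^{+}+x^{-1}v_1(x)\mathcal{I},\qquad B_1(x)=\frac{\tau_1aq(1-q^2)(x-1)(bx-c)}{x},$$ $$W_2=B_2(x)T^{-}+x^{-1}v_2(x)\mathcal{I},\qquad B_2(x)=\frac{\tau_1(1-q^{-2})(x-cq)(x-aq)}{x},$$ with some quadratic polynomials $v_1(x),v_2(x)$. Moreover, with appropriate choices of the parameters $\tau_0,\tau_1,\tau_3$ (which can be different for $W_1$ and for $W_2$) and by an affine transformation $Y\to\widetilde Y=\alpha Y+\beta\mathcal{I}$, one can reduce the commutation relations of these operators to those of the $\mathbb{Z}_3$-symmetric presentation of the Askey-Wilson algebra: $$\widetilde YW_1-qW_1\widetilde Y=W_2+\omega_1\mathcal{I},\qquad W_1W_2-qW_2W_1=\widetilde Y+\omega_2\mathcal{I},\qquad W_2\widetilde Y-q\widetilde YW_2=W_1+\omega_3\mathcal{I},$$ with constants $\omega_1,\omega_2,\omega_3$. Thus the operators $Y$ (after the affine transformation), $W_1$, $W_2$ form an Askey-Wilson triple.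
   Context: $q$ is the base parameter. $T^{+}f(x)=f(qx)$, $T^{-}f(x)=f(x/q)$, and $\mathcal{I}$ is the identity operator. $X$ is multiplication by $x$, and $$Y=B(x)T^{+}+D(x)T^{-}-(B(x)+D(x))\mathcal{I},\quad B(x)=aq\,x^{-2}(x-1)(bx-c),\quad D(x)=x^{-2}(x-aq)(x-cq)$$ is the q-difference operator of the big q-Jacobi polynomials with parameters $a,b,c$. The operator $W=\tau_1XY+\tau_2YX+\tau_3X+\tau_4Y+\tau_0\mathcal{I}$, with parameters $\tau_0,\dots,\tau_4$, is the algebraic q-Heun operator of big q-Jacobi type. Three operators satisfying relations of the displayed $\mathbb{Z}_3$-symmetric form are said to form an Askey-Wilson triple.
   Formalization: The reduction to the Z_3-symmetric relations is stated for q ≠ 0, q² ≠ 1 and a, b, c all nonzero; otherwise no solution with α ≠ 0 exists. "Quadratic" for v_1, v_2 means degree at most 2, since the leading coefficient can vanish for special τ_3. *)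

theory Defs
  imports Complex_Main "HOL-Computational_Algebra.Polynomial"
begin

text \<open>
  Operators act on functions on the punctured plane \<open>x \<noteq> 0\<close>, encoded as total functions
  \<open>complex \<Rightarrow> complex\<close>. For \<open>q \<noteq> 0\<close> the value of every operator below at a nonzero point depends
  only on the values of the argument at nonzero points, so operators (and their compositions)
  are compared at nonzero points only; the values at \<open>0\<close> are junk.
\<close>

type_synonym operator = "(complex \<Rightarrow> complex) \<Rightarrow> complex \<Rightarrow> complex"

definition op_eq :: "operator \<Rightarrow> operator \<Rightarrow> bool" (infix "\<doteq>" 50) where
  "P \<doteq> Q \<longleftrightarrow> (\<forall>f x. x \<noteq> 0 \<longrightarrow> P f x = Q f x)"

definition T_plus :: "complex \<Rightarrow> operator" where
  "T_plus q f = (\<lambda>x. f (q * x))"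

definition T_minus :: "complex \<Rightarrow> operator" where
  "T_minus q f = (\<lambda>x. f (x / q))"

definition X_op :: operator where
  "X_op f = (\<lambda>x. x * f x)"

definition coeff_B :: "complex \<Rightarrow> complex \<Rightarrow> complex \<Rightarrow> complex \<Rightarrow> complex \<Rightarrow> complex" where
  "coeff_B q a b c x = a * q * (x - 1) * (b * x - c) / x\<^sup>2"

definition coeff_D :: "complex \<Rightarrow> complex \<Rightarrow> complex \<Rightarrow> complex \<Rightarrow> complex" where
  "coeff_D q a c x = (x - a * q) * (x - c * q) / x\<^sup>2"

definition Y_op :: "complex \<Rightarrow> complex \<Rightarrow> complex \<Rightarrow> complex \<Rightarrow> operator" where
  "Y_op q a b c f = (\<lambda>x. coeff_B q a b c x * T_plus q f x + coeff_D q a c x * T_minus q f x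
     - (coeff_B q a b c x + coeff_D q a c x) * f x)"

definition affine_op :: "complex \<Rightarrow> complex \<Rightarrow> operator \<Rightarrow> operator" where
  "affine_op \<alpha> \<beta> P f = (\<lambda>x. \<alpha> * P f x + \<beta> * f x)"

definition W_op :: "complex \<Rightarrow> complex \<Rightarrow> complex \<Rightarrow> complex \<Rightarrow>
    complex \<Rightarrow> complex \<Rightarrow> complex \<Rightarrow> complex \<Rightarrow> complex \<Rightarrow> operator" where
  "W_op q a b c \<tau>\<^sub>0 \<tau>\<^sub>1 \<tau>\<^sub>2 \<tau>\<^sub>3 \<tau>\<^sub>4 f = (\<lambda>x.
     \<tau>\<^sub>1 * X_op (Y_op q a b c f) x + \<tau>\<^sub>2 * Y_op q a b c (X_op f) x
     + \<tau>\<^sub>3 * X_op f x + \<tau>\<^sub>4 * Y_op q a b c f x + \<tau>\<^sub>0 * f x)"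

definition W1_op :: "complex \<Rightarrow> complex \<Rightarrow> complex \<Rightarrow> complex \<Rightarrow>
    complex \<Rightarrow> complex \<Rightarrow> complex \<Rightarrow> operator" where
  "W1_op q a b c \<tau>\<^sub>0 \<tau>\<^sub>1 \<tau>\<^sub>3 = W_op q a b c \<tau>\<^sub>0 \<tau>\<^sub>1 (- q * \<tau>\<^sub>1) \<tau>\<^sub>3 0"

definition W2_op :: "complex \<Rightarrow> complex \<Rightarrow> complex \<Rightarrow> complex \<Rightarrow>
    complex \<Rightarrow> complex \<Rightarrow> complex \<Rightarrow> operator" where
  "W2_op q a b c \<tau>\<^sub>0 \<tau>\<^sub>1 \<tau>\<^sub>3 = W_op q a b c \<tau>\<^sub>0 \<tau>\<^sub>1 (- inverse q * \<tau>\<^sub>1) \<tau>\<^sub>3 0"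

definition q_commutator :: "complex \<Rightarrow> operator \<Rightarrow> operator \<Rightarrow> operator" where
  "q_commutator q P Q f = (\<lambda>x. P (Q f) x - q * Q (P f) x)"

definition askey_wilson_triple :: "complex \<Rightarrow> operator \<Rightarrow> operator \<Rightarrow> operator \<Rightarrow> bool" where
  "askey_wilson_triple q P Q R \<longleftrightarrow> (\<exists>\<omega>\<^sub>1 \<omega>\<^sub>2 \<omega>\<^sub>3.
     q_commutator q P Q \<doteq> affine_op 1 \<omega>\<^sub>1 R \<and>
     q_commutator q Q R \<doteq> affine_op 1 \<omega>\<^sub>2 P \<and>
     q_commutator q R P \<doteq> affine_op 1 \<omega>\<^sub>3 Q)"

end

theory Submission
  imports Defs
begin

text \<open>
  Write \<open>P x = x\<^sup>2 B x\<close> and \<open>R x = x\<^sup>2 D x\<close>. These are quadratic polynomials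
  \<open>P = p\<^sub>0 + p\<^sub>1 x + p\<^sub>2 x\<^sup>2\<close> and \<open>R = r\<^sub>0 + r\<^sub>1 x + r\<^sub>2 x\<^sup>2\<close>, and the argument rests on
  one relation between their coefficients, \<open>r\<^sub>0 = q p\<^sub>0\<close>; here \<open>p\<^sub>0 = acq\<close>, \<open>p\<^sub>2 = abq\<close> and \<open>r\<^sub>2 = 1\<close>.

  The shift \<open>T\<^sup>-\<close> drops out of \<open>XY - q YX\<close> and \<open>T\<^sup>+\<close> drops out of \<open>XY - q\<^sup>-\<^sup>1 YX\<close>, because moving \<open>X\<close>
  past \<open>T\<^sup>\<plusminus>\<close> costs a factor \<open>q\<^sup>\<plusminus>\<^sup>1\<close>. Choosing \<open>\<tau>\<^sub>0\<close> so that the constant term of the multiplication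
  part vanishes, and \<open>\<beta> = \<alpha> (p\<^sub>2 + r\<^sub>2)\<close> likewise for \<open>Y\<close>, one gets
  \<open>W\<^sub>1 = k x\<^sup>-\<^sup>1 P T\<^sup>+ + (e x - k p\<^sub>0 x\<^sup>-\<^sup>1)\<close>, \<open>W\<^sub>2 = m x\<^sup>-\<^sup>1 R T\<^sup>- + (h x - m r\<^sub>0 x\<^sup>-\<^sup>1)\<close> and
  \<open>Y' = \<alpha> x\<^sup>-\<^sup>2 (P T\<^sup>+ + R T\<^sup>- - (p\<^sub>1 + r\<^sub>1) x - (p\<^sub>0 + r\<^sub>0))\<close>, where \<open>e\<close> and \<open>h\<close> are free because \<open>\<tau>\<^sub>3\<close>
  is.

  In this form the three \<open>q\<close>-commutators close up to scalars: each equals a constant plus an operator of the remaining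
  kind, with parameters that are monomials in \<open>\<alpha>, k, e, m, h\<close> times functions of \<open>q\<close>
  (\<open>q_commutator_Y_form_W_form\<close>, \<open>q_commutator_W_form_Y_form\<close>,
  \<open>q_commutator_W_form_W_form\<close>). The exchange \<open>q \<leftrightarrow> q\<^sup>-\<^sup>1\<close>, \<open>P \<leftrightarrow> R\<close> preserves \<open>Y'\<close>, swaps \<open>W\<^sub>1\<close> with
  \<open>W\<^sub>2\<close> and respects \<open>r\<^sub>0 = q p\<^sub>0\<close>, so the relation for \<open>W\<^sub>2, Y'\<close> is the mirror image of the one for
  \<open>Y', W\<^sub>1\<close>.

  The theorem thus reduces to the scalar equations
  \<open>m = \<alpha> e (q\<^sup>-\<^sup>1 - q)\<close>, \<open>h = \<alpha> k p\<^sub>2 (q\<^sup>-\<^sup>1 - q)\<close>, \<open>k = \<alpha> h (1 - q\<^sup>2)\<close>, \<open>e = \<alpha> m p\<^sub>2 (1 - q\<^sup>2)\<close>,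
  \<open>e h = k m p\<^sub>2\<close>, \<open>\<alpha> = - k m p\<^sub>0 (1 - q\<^sup>2)\<close>. The first four are compatible exactly when
  \<open>\<alpha>\<^sup>2 (1 - q\<^sup>2)\<^sup>2 a b = 1\<close>; they imply the fifth, and the last one fixes \<open>m\<close> once \<open>k = 1\<close>.
\<close>

section \<open>Second-order shift operators\<close>

definition shift_op :: "complex \<Rightarrow> (complex \<Rightarrow> complex) \<Rightarrow> (complex \<Rightarrow> complex) \<Rightarrow>
    (complex \<Rightarrow> complex) \<Rightarrow> operator" where
  "shift_op q u v w f = (\<lambda>x. u x * f (q * x) + v x * f x + w x * f (x / q))"

lemma shift_op_inverse: "shift_op (inverse q) u v w = shift_op q w v u"
  by (rule ext)+ (simp add: shift_op_def field_simps)

text \<open>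
  Composition does not respect \<open>\<doteq>\<close> for arbitrary operators, since the outer operator might look
  at the value at \<open>0\<close>. A shift operator evaluated at a nonzero point never does, and this is all
  that is needed to transfer a commutation relation along \<open>\<doteq>\<close>.
\<close>

definition is_shift_op :: "complex \<Rightarrow> operator \<Rightarrow> bool" where
  "is_shift_op q P \<longleftrightarrow> (\<exists>u v w. P = shift_op q u v w)"

lemma q_commutator_transfer:
  assumes "q \<noteq> 0" and "P \<doteq> P'" "Q \<doteq> Q'" "R \<doteq> R'"
    and "is_shift_op q P'" "is_shift_op q Q'"
    and "q_commutator q P' Q' \<doteq> affine_op 1 \<omega> R'"
  shows "q_commutator q P Q \<doteq> affine_op 1 \<omega> R"
  using assms by (auto simp: is_shift_op_def op_eq_def q_commutator_def shift_op_def affine_op_def)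

text \<open>
  The five assumptions compare the coefficients of \<open>T\<^sup>+\<^sup>2, T\<^sup>-\<^sup>2, T\<^sup>+, T\<^sup>-\<close> and the identity, which turns
  a commutation relation into identities between rational functions of \<open>x\<close>.
\<close>

lemma q_commutator_shift_op:
  assumes q: "q \<noteq> 0"
    and "\<And>x. x \<noteq> 0 \<Longrightarrow> u x * u' (q * x) = q * (u' x * u (q * x))"
    and "\<And>x. x \<noteq> 0 \<Longrightarrow> w x * w' (x / q) = q * (w' x * w (x / q))"
    and "\<And>x. x \<noteq> 0 \<Longrightarrow>
      u x * v' (q * x) + v x * u' x - q * (u' x * v (q * x) + v' x * u x) = u'' x"
    and "\<And>x. x \<noteq> 0 \<Longrightarrow>
      w x * v' (x / q) + v x * w' x - q * (w' x * v (x / q) + v' x * w x) = w'' x"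
    and "\<And>x. x \<noteq> 0 \<Longrightarrow>
      u x * w' (q * x) + v x * v' x + w x * u' (x / q)
        - q * (u' x * w (q * x) + v' x * v x + w' x * u (x / q)) = v'' x + \<omega>"
  shows "q_commutator q (shift_op q u v w) (shift_op q u' v' w') \<doteq>
    affine_op 1 \<omega> (shift_op q u'' v'' w'')"
  unfolding op_eq_def
proof (intro allI impI)
  fix f :: "complex \<Rightarrow> complex" and x :: complex
  assume x: "x \<noteq> 0"
  have "q_commutator q (shift_op q u v w) (shift_op q u' v' w') f x =
      (u x * u' (q * x) - q * (u' x * u (q * x))) * f (q * (q * x))
    + (u x * v' (q * x) + v x * u' x - q * (u' x * v (q * x) + v' x * u x)) * f (q * x)
    + (u x * w' (q * x) + v x * v' x + w x * u' (x / q)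
        - q * (u' x * w (q * x) + v' x * v x + w' x * u (x / q))) * f x
    + (w x * v' (x / q) + v x * w' x - q * (w' x * v (x / q) + v' x * w x)) * f (x / q)
    + (w x * w' (x / q) - q * (w' x * w (x / q))) * f (x / q / q)"
    using q by (simp add: q_commutator_def shift_op_def algebra_simps)
  then show "q_commutator q (shift_op q u v w) (shift_op q u' v' w') f x =
      affine_op 1 \<omega> (shift_op q u'' v'' w'') f x"
    using x by (simp add: assms(2-6)) (simp add: affine_op_def shift_op_def algebra_simps)
qed

text \<open>
  Swapping the arguments of a \<open>q\<close>-commutator inverts \<open>q\<close>; this is what makes the mirror symmetry
  \<open>q \<leftrightarrow> q\<^sup>-\<^sup>1\<close> usable.
\<close>

lemma q_commutator_swap:
  "q \<noteq> 0 \<Longrightarrow> q_commutator q P Q = (\<lambda>f x. - q * q_commutator (inverse q) Q P f x)"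
  by (rule ext)+ (simp add: q_commutator_def field_simps)

section \<open>Normal forms and their commutation relations\<close>

definition quad :: "complex \<Rightarrow> complex \<Rightarrow> complex \<Rightarrow> complex \<Rightarrow> complex" where
  "quad p\<^sub>0 p\<^sub>1 p\<^sub>2 x = p\<^sub>0 + p\<^sub>1 * x + p\<^sub>2 * x\<^sup>2"

definition Y_form :: "complex \<Rightarrow> complex \<Rightarrow> complex \<Rightarrow> complex \<Rightarrow> complex \<Rightarrow>
    complex \<Rightarrow> complex \<Rightarrow> complex \<Rightarrow> operator" where
  "Y_form q p\<^sub>0 p\<^sub>1 p\<^sub>2 r\<^sub>0 r\<^sub>1 r\<^sub>2 \<alpha> = shift_op q
     (\<lambda>x. \<alpha> * quad p\<^sub>0 p\<^sub>1 p\<^sub>2 x / x\<^sup>2)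
     (\<lambda>x. - \<alpha> * ((p\<^sub>1 + r\<^sub>1) * x + (p\<^sub>0 + r\<^sub>0)) / x\<^sup>2)
     (\<lambda>x. \<alpha> * quad r\<^sub>0 r\<^sub>1 r\<^sub>2 x / x\<^sup>2)"

text \<open>
  The multiplication part is tied to the shift part through \<open>- k p\<^sub>0 x\<^sup>-\<^sup>1\<close>; only \<open>e\<close> is independent of it.
  One definition serves both \<open>W\<^sub>1\<close> and \<open>W\<^sub>2\<close>: the latter has base \<open>q\<^sup>-\<^sup>1\<close> and the polynomial of \<open>T\<^sup>-\<close>.
\<close>

definition W_form :: "complex \<Rightarrow> complex \<Rightarrow> complex \<Rightarrow> complex \<Rightarrow> complex \<Rightarrow> complex \<Rightarrow> operator" where
  "W_form q p\<^sub>0 p\<^sub>1 p\<^sub>2 k e = shift_op q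
     (\<lambda>x. k * quad p\<^sub>0 p\<^sub>1 p\<^sub>2 x / x) (\<lambda>x. e * x - k * p\<^sub>0 / x) (\<lambda>_. 0)"

lemma Y_form_inverse:
  "Y_form (inverse q) r\<^sub>0 r\<^sub>1 r\<^sub>2 p\<^sub>0 p\<^sub>1 p\<^sub>2 \<alpha> = Y_form q p\<^sub>0 p\<^sub>1 p\<^sub>2 r\<^sub>0 r\<^sub>1 r\<^sub>2 \<alpha>"
  by (simp add: Y_form_def shift_op_inverse add.commute)

lemma W_form_inverse:
  "W_form (inverse q) r\<^sub>0 r\<^sub>1 r\<^sub>2 m h = shift_op q
     (\<lambda>_. 0) (\<lambda>x. h * x - m * r\<^sub>0 / x) (\<lambda>x. m * quad r\<^sub>0 r\<^sub>1 r\<^sub>2 x / x)"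
  by (simp add: W_form_def shift_op_inverse)

lemma is_shift_op_Y_form: "is_shift_op q (Y_form q p\<^sub>0 p\<^sub>1 p\<^sub>2 r\<^sub>0 r\<^sub>1 r\<^sub>2 \<alpha>)"
  unfolding is_shift_op_def Y_form_def by blast

lemma is_shift_op_W_form:
  "is_shift_op q (W_form q p\<^sub>0 p\<^sub>1 p\<^sub>2 k e)"
  "is_shift_op q (W_form (inverse q) r\<^sub>0 r\<^sub>1 r\<^sub>2 m h)"
  unfolding is_shift_op_def W_form_inverse unfolding W_form_def by blast+

lemma W_form_scale: "s * W_form q p\<^sub>0 p\<^sub>1 p\<^sub>2 k e f x = W_form q p\<^sub>0 p\<^sub>1 p\<^sub>2 (s * k) (s * e) f x"
  by (simp add: W_form_def shift_op_def algebra_simps)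

text \<open>
  The coefficient of \<open>T\<^sup>+\<close> in the \<open>q\<close>-commutator cancels because the multiplication parts of both
  operators have no constant term and because \<open>p\<^sub>0 + r\<^sub>0 = (1 + q) p\<^sub>0\<close>; the same relation removes
  \<open>x\<^sup>-\<^sup>2\<close> and \<open>x\<^sup>-\<^sup>3\<close> from the multiplication part of the result.
\<close>

lemma q_commutator_Y_form_W_form:
  assumes q: "q \<noteq> 0" and r0: "r\<^sub>0 = q * p\<^sub>0"
  obtains \<omega> where "q_commutator q (Y_form q p\<^sub>0 p\<^sub>1 p\<^sub>2 r\<^sub>0 r\<^sub>1 r\<^sub>2 \<alpha>) (W_form q p\<^sub>0 p\<^sub>1 p\<^sub>2 k e) \<doteq>
    affine_op 1 \<omega> (W_form (inverse q) r\<^sub>0 r\<^sub>1 r\<^sub>2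
      (\<alpha> * e * (inverse q - q)) (\<alpha> * k * p\<^sub>2 * r\<^sub>2 * (inverse q - q)))"
proof
  define \<omega> where "\<omega> = \<alpha> * (1 - q) * (k * (r\<^sub>2 * p\<^sub>1 + r\<^sub>1 * p\<^sub>2 / q) - (p\<^sub>1 + r\<^sub>1) * e)"
  show "q_commutator q (Y_form q p\<^sub>0 p\<^sub>1 p\<^sub>2 r\<^sub>0 r\<^sub>1 r\<^sub>2 \<alpha>) (W_form q p\<^sub>0 p\<^sub>1 p\<^sub>2 k e) \<doteq>
    affine_op 1 \<omega> (W_form (inverse q) r\<^sub>0 r\<^sub>1 r\<^sub>2
      (\<alpha> * e * (inverse q - q)) (\<alpha> * k * p\<^sub>2 * r\<^sub>2 * (inverse q - q)))"
    unfolding Y_form_def W_form_inverse unfolding W_form_def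
    by (rule q_commutator_shift_op[OF q])
      (simp_all add: r0 \<omega>_def quad_def q field_simps power2_eq_square power3_eq_cube)
qed

text \<open>
  The mirror image of the preceding relation under \<open>q \<leftrightarrow> q\<^sup>-\<^sup>1\<close>, \<open>P \<leftrightarrow> R\<close>; reversing the arguments of
  the \<open>q\<close>-commutator turns the factor \<open>q - q\<^sup>-\<^sup>1\<close> into \<open>- q (q - q\<^sup>-\<^sup>1) = 1 - q\<^sup>2\<close>.
\<close>

lemma q_commutator_W_form_Y_form:
  assumes q: "q \<noteq> 0" and r0: "r\<^sub>0 = q * p\<^sub>0"
  obtains \<omega> where
    "q_commutator q (W_form (inverse q) r\<^sub>0 r\<^sub>1 r\<^sub>2 m h) (Y_form q p\<^sub>0 p\<^sub>1 p\<^sub>2 r\<^sub>0 r\<^sub>1 r\<^sub>2 \<alpha>) \<doteq>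
      affine_op 1 \<omega> (W_form q p\<^sub>0 p\<^sub>1 p\<^sub>2 (\<alpha> * h * (1 - q\<^sup>2)) (\<alpha> * m * p\<^sub>2 * r\<^sub>2 * (1 - q\<^sup>2)))"
proof -
  have "inverse q \<noteq> 0" "p\<^sub>0 = inverse q * r\<^sub>0"
    using q r0 by auto
  then obtain \<omega> where *:
    "q_commutator (inverse q) (Y_form q p\<^sub>0 p\<^sub>1 p\<^sub>2 r\<^sub>0 r\<^sub>1 r\<^sub>2 \<alpha>) (W_form (inverse q) r\<^sub>0 r\<^sub>1 r\<^sub>2 m h) \<doteq>
      affine_op 1 \<omega> (W_form q p\<^sub>0 p\<^sub>1 p\<^sub>2
        (\<alpha> * h * (q - inverse q)) (\<alpha> * m * r\<^sub>2 * p\<^sub>2 * (q - inverse q)))"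
    using q_commutator_Y_form_W_form[of "inverse q" p\<^sub>0 r\<^sub>0 r\<^sub>1 r\<^sub>2 p\<^sub>1 p\<^sub>2 \<alpha> m h]
    unfolding Y_form_inverse inverse_inverse_eq by metis
  have "- q * (\<alpha> * h * (q - inverse q)) = \<alpha> * h * (1 - q\<^sup>2)"
    "- q * (\<alpha> * m * r\<^sub>2 * p\<^sub>2 * (q - inverse q)) = \<alpha> * m * p\<^sub>2 * r\<^sub>2 * (1 - q\<^sup>2)"
    using q by (simp_all add: field_simps power2_eq_square)
  note scale = W_form_scale[of "- q" q p\<^sub>0 p\<^sub>1 p\<^sub>2 "\<alpha> * h * (q - inverse q)"
      "\<alpha> * m * r\<^sub>2 * p\<^sub>2 * (q - inverse q)", unfolded this]
  show thesis
  proof (rule that[of "- q * \<omega>"])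
    show "q_commutator q (W_form (inverse q) r\<^sub>0 r\<^sub>1 r\<^sub>2 m h) (Y_form q p\<^sub>0 p\<^sub>1 p\<^sub>2 r\<^sub>0 r\<^sub>1 r\<^sub>2 \<alpha>) \<doteq>
      affine_op 1 (- q * \<omega>) (W_form q p\<^sub>0 p\<^sub>1 p\<^sub>2
        (\<alpha> * h * (1 - q\<^sup>2)) (\<alpha> * m * p\<^sub>2 * r\<^sub>2 * (1 - q\<^sup>2)))"
      using * unfolding q_commutator_swap[OF q] op_eq_def affine_op_def scale[symmetric]
      by (simp add: algebra_simps)
  qed
qed

text \<open>
  In degree three, \<open>P(x) R(qx) / q\<close> and \<open>q\<^sup>2 R(x) P(x/q)\<close> have the same coefficient, so no term
  linear in \<open>x\<close> arises; the quadratic term is cancelled by the condition on \<open>e h\<close>.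
\<close>

lemma q_commutator_W_form_W_form:
  assumes q: "q \<noteq> 0" and r0: "r\<^sub>0 = q * p\<^sub>0" and eh: "e * h = k * m * p\<^sub>2 * r\<^sub>2"
  obtains \<omega> where
    "q_commutator q (W_form q p\<^sub>0 p\<^sub>1 p\<^sub>2 k e) (W_form (inverse q) r\<^sub>0 r\<^sub>1 r\<^sub>2 m h) \<doteq>
      affine_op 1 \<omega> (Y_form q p\<^sub>0 p\<^sub>1 p\<^sub>2 r\<^sub>0 r\<^sub>1 r\<^sub>2 (- k * m * p\<^sub>0 * (1 - q\<^sup>2)))"
proof
  define \<omega> where "\<omega> = (1 - q) *
    (k * m * (p\<^sub>0 * r\<^sub>2 * q + p\<^sub>1 * r\<^sub>1 + p\<^sub>2 * p\<^sub>0) - e * m * r\<^sub>0 - h * k * p\<^sub>0)"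
  show "q_commutator q (W_form q p\<^sub>0 p\<^sub>1 p\<^sub>2 k e) (W_form (inverse q) r\<^sub>0 r\<^sub>1 r\<^sub>2 m h) \<doteq>
      affine_op 1 \<omega> (Y_form q p\<^sub>0 p\<^sub>1 p\<^sub>2 r\<^sub>0 r\<^sub>1 r\<^sub>2 (- k * m * p\<^sub>0 * (1 - q\<^sup>2)))"
    unfolding Y_form_def W_form_inverse unfolding W_form_def
  proof (rule q_commutator_shift_op[OF q])
    fix x :: complex
    assume x: "x \<noteq> 0"
    have "(e * x - k * p\<^sub>0 / x) * (h * x - m * r\<^sub>0 / x)
        = (e * h) * x\<^sup>2 - (e * m * r\<^sub>0 + h * k * p\<^sub>0) + k * m * p\<^sub>0 * r\<^sub>0 / x\<^sup>2"
      using x by (simp add: field_simps power2_eq_square)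
    then have product: "(e * x - k * p\<^sub>0 / x) * (h * x - m * r\<^sub>0 / x)
        = k * m * p\<^sub>2 * r\<^sub>2 * x\<^sup>2 - (e * m * r\<^sub>0 + h * k * p\<^sub>0) + k * m * p\<^sub>0 * r\<^sub>0 / x\<^sup>2"
      by (simp only: eh)
    have "k * quad p\<^sub>0 p\<^sub>1 p\<^sub>2 x / x * (m * quad r\<^sub>0 r\<^sub>1 r\<^sub>2 (q * x) / (q * x))
        - q * (m * quad r\<^sub>0 r\<^sub>1 r\<^sub>2 x / x * (k * quad p\<^sub>0 p\<^sub>1 p\<^sub>2 (x / q) / (x / q)))
        + (1 - q) * ((e * x - k * p\<^sub>0 / x) * (h * x - m * r\<^sub>0 / x))
      = - (- k * m * p\<^sub>0 * (1 - q\<^sup>2)) * ((p\<^sub>1 + r\<^sub>1) * x + (p\<^sub>0 + r\<^sub>0)) / x\<^sup>2 + \<omega>"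
      unfolding product
      using x q by (simp add: \<omega>_def r0 quad_def field_simps power2_eq_square power3_eq_cube)
    moreover have "A + U * V + 0 * 0 - q * (0 * 0 + V * U + C) = A - q * C + (1 - q) * (U * V)"
      for A C U V :: complex
      by (simp add: algebra_simps)
    ultimately show "k * quad p\<^sub>0 p\<^sub>1 p\<^sub>2 x / x * (m * quad r\<^sub>0 r\<^sub>1 r\<^sub>2 (q * x) / (q * x))
        + (e * x - k * p\<^sub>0 / x) * (h * x - m * r\<^sub>0 / x) + 0 * 0
        - q * (0 * 0 + (h * x - m * r\<^sub>0 / x) * (e * x - k * p\<^sub>0 / x)
          + m * quad r\<^sub>0 r\<^sub>1 r\<^sub>2 x / x * (k * quad p\<^sub>0 p\<^sub>1 p\<^sub>2 (x / q) / (x / q)))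
      = - (- k * m * p\<^sub>0 * (1 - q\<^sup>2)) * ((p\<^sub>1 + r\<^sub>1) * x + (p\<^sub>0 + r\<^sub>0)) / x\<^sup>2 + \<omega>"
      by (simp only:)
  qed (simp_all add: r0 q field_simps power2_eq_square)
qed

section \<open>The operators of the big q-Jacobi family in normal form\<close>

text \<open>
  The numerator of the multiplication part of \<open>W\<close> for \<open>\<tau>\<^sub>4 = 0\<close>; it depends on \<open>\<tau>\<^sub>1\<close> and \<open>\<tau>\<^sub>2\<close> only
  through \<open>t = \<tau>\<^sub>1 + \<tau>\<^sub>2\<close>, since \<open>X\<close> commutes with multiplication operators.
\<close>

definition W_mult_poly :: "complex \<Rightarrow> complex \<Rightarrow> complex \<Rightarrow> complex \<Rightarrow>
    complex \<Rightarrow> complex \<Rightarrow> complex \<Rightarrow> complex poly" where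
  "W_mult_poly q a b c t \<tau>\<^sub>0 \<tau>\<^sub>3 =
     [:- t * (a * c * q + a * c * q\<^sup>2),
       \<tau>\<^sub>0 + t * (a * q * (b + c) + (a + c) * q),
       \<tau>\<^sub>3 - t * (a * b * q + 1):]"

lemma degree_W_mult_poly: "degree (W_mult_poly q a b c t \<tau>\<^sub>0 \<tau>\<^sub>3) \<le> 2"
  by (simp add: W_mult_poly_def)

text \<open>
  Moving \<open>X\<close> from the left to the right of \<open>T\<^sup>\<plusminus>\<close> multiplies by \<open>q\<^sup>\<plusminus>\<^sup>1\<close>, hence the factors
  \<open>\<tau>\<^sub>1 + q\<^sup>\<plusminus>\<^sup>1 \<tau>\<^sub>2\<close>. Each of the two specializations of \<open>\<tau>\<^sub>2\<close> annihilates one of them.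
\<close>

lemma W_op_apply:
  assumes "q \<noteq> 0" "x \<noteq> 0"
  shows "W_op q a b c \<tau>\<^sub>0 \<tau>\<^sub>1 \<tau>\<^sub>2 \<tau>\<^sub>3 0 f x =
      (\<tau>\<^sub>1 + q * \<tau>\<^sub>2) * (a * q * (x - 1) * (b * x - c) / x) * T_plus q f x
    + (\<tau>\<^sub>1 + \<tau>\<^sub>2 / q) * ((x - a * q) * (x - c * q) / x) * T_minus q f x
    + inverse x * poly (W_mult_poly q a b c (\<tau>\<^sub>1 + \<tau>\<^sub>2) \<tau>\<^sub>0 \<tau>\<^sub>3) x * f x"
  using assms
  by (simp add: W_op_def X_op_def Y_op_def T_plus_def T_minus_def coeff_B_def coeff_D_def
      W_mult_poly_def field_simps power2_eq_square power3_eq_cube)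

lemma W1_op_normal_form:
  assumes "q \<noteq> 0"
  shows "W1_op q a b c \<tau>\<^sub>0 \<tau>\<^sub>1 \<tau>\<^sub>3 \<doteq>
    (\<lambda>f x. \<tau>\<^sub>1 * a * q * (1 - q\<^sup>2) * (x - 1) * (b * x - c) / x * T_plus q f x
      + inverse x * poly (W_mult_poly q a b c (\<tau>\<^sub>1 + - q * \<tau>\<^sub>1) \<tau>\<^sub>0 \<tau>\<^sub>3) x * f x)"
  unfolding op_eq_def W1_op_def
proof (intro allI impI)
  fix f and x :: complex
  assume x: "x \<noteq> 0"
  have "\<tau>\<^sub>1 + q * (- q * \<tau>\<^sub>1) = \<tau>\<^sub>1 * (1 - q\<^sup>2)" "\<tau>\<^sub>1 + - q * \<tau>\<^sub>1 / q = 0"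
    using assms by (simp_all add: algebra_simps power2_eq_square)
  then show "W_op q a b c \<tau>\<^sub>0 \<tau>\<^sub>1 (- q * \<tau>\<^sub>1) \<tau>\<^sub>3 0 f x =
      \<tau>\<^sub>1 * a * q * (1 - q\<^sup>2) * (x - 1) * (b * x - c) / x * T_plus q f x
      + inverse x * poly (W_mult_poly q a b c (\<tau>\<^sub>1 + - q * \<tau>\<^sub>1) \<tau>\<^sub>0 \<tau>\<^sub>3) x * f x"
    by (simp only: W_op_apply[OF assms x]) (simp add: mult_ac)
qed

lemma W2_op_normal_form:
  assumes "q \<noteq> 0"
  shows "W2_op q a b c \<tau>\<^sub>0 \<tau>\<^sub>1 \<tau>\<^sub>3 \<doteq>
    (\<lambda>f x. \<tau>\<^sub>1 * (1 - inverse (q\<^sup>2)) * (x - c * q) * (x - a * q) / x * T_minus q f x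
      + inverse x * poly (W_mult_poly q a b c (\<tau>\<^sub>1 + - inverse q * \<tau>\<^sub>1) \<tau>\<^sub>0 \<tau>\<^sub>3) x * f x)"
  unfolding op_eq_def W2_op_def
proof (intro allI impI)
  fix f and x :: complex
  assume x: "x \<noteq> 0"
  have "\<tau>\<^sub>1 + q * (- inverse q * \<tau>\<^sub>1) = 0"
    "\<tau>\<^sub>1 + - inverse q * \<tau>\<^sub>1 / q = \<tau>\<^sub>1 * (1 - inverse (q\<^sup>2))"
    using assms by (simp_all add: field_simps power2_eq_square)
  then show "W_op q a b c \<tau>\<^sub>0 \<tau>\<^sub>1 (- inverse q * \<tau>\<^sub>1) \<tau>\<^sub>3 0 f x =
      \<tau>\<^sub>1 * (1 - inverse (q\<^sup>2)) * (x - c * q) * (x - a * q) / x * T_minus q f x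
      + inverse x * poly (W_mult_poly q a b c (\<tau>\<^sub>1 + - inverse q * \<tau>\<^sub>1) \<tau>\<^sub>0 \<tau>\<^sub>3) x * f x"
    by (simp only: W_op_apply[OF assms x]) (simp add: mult_ac)
qed

text \<open>
  The value of \<open>\<tau>\<^sub>0\<close> is the one for which \<open>W_mult_poly\<close> has no linear term, and \<open>\<tau>\<^sub>3\<close> is shifted so
  that its quadratic coefficient becomes \<open>e\<close>. The case of \<open>W\<^sub>2\<close> is analogous.
\<close>

lemma W1_op_W_form:
  assumes "q \<noteq> 0"
  shows "W1_op q a b c (- \<tau>\<^sub>1 * (1 - q) * (a * q * (b + c) + (a + c) * q)) \<tau>\<^sub>1
      (e + \<tau>\<^sub>1 * (1 - q) * (a * b * q + 1)) \<doteq>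
    W_form q (a * c * q) (- a * q * (b + c)) (a * b * q) (\<tau>\<^sub>1 * (1 - q\<^sup>2)) e"
  unfolding op_eq_def W1_op_def
  using assms by (auto simp: W_op_apply W_mult_poly_def W_form_def shift_op_def quad_def T_plus_def T_minus_def
      field_simps power2_eq_square power3_eq_cube)

lemma W2_op_W_form:
  assumes "q \<noteq> 0"
  shows "W2_op q a b c (- \<tau>\<^sub>1 * (1 - inverse q) * (a * q * (b + c) + (a + c) * q)) \<tau>\<^sub>1
      (h + \<tau>\<^sub>1 * (1 - inverse q) * (a * b * q + 1)) \<doteq>
    W_form (inverse q) (a * c * q\<^sup>2) (- (a + c) * q) 1 (\<tau>\<^sub>1 * (1 - inverse (q\<^sup>2))) h"
  unfolding op_eq_def W2_op_def
  using assms by (auto simp: W_op_apply W_mult_poly_def W_form_def shift_op_def quad_def T_plus_def T_minus_def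
      field_simps power2_eq_square power3_eq_cube)

lemma affine_Y_op_Y_form:
  assumes "q \<noteq> 0"
  shows "affine_op \<alpha> (\<alpha> * (a * b * q + 1)) (Y_op q a b c) \<doteq>
    Y_form q (a * c * q) (- a * q * (b + c)) (a * b * q) (a * c * q\<^sup>2) (- (a + c) * q) 1 \<alpha>"
  unfolding op_eq_def
  using assms by (auto simp: affine_op_def Y_op_def Y_form_def shift_op_def quad_def
      T_plus_def T_minus_def coeff_B_def coeff_D_def field_simps power2_eq_square)

theorem mainTheorem6:
  fixes q a b c :: complex
  assumes "q \<noteq> 0"
  shows
    "(\<forall>\<tau>\<^sub>0 \<tau>\<^sub>1 \<tau>\<^sub>3. \<exists>v\<^sub>1 :: complex poly. degree v\<^sub>1 \<le> 2 \<and>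
        W1_op q a b c \<tau>\<^sub>0 \<tau>\<^sub>1 \<tau>\<^sub>3 \<doteq>
          (\<lambda>f x. \<tau>\<^sub>1 * a * q * (1 - q\<^sup>2) * (x - 1) * (b * x - c) / x * T_plus q f x
                 + inverse x * poly v\<^sub>1 x * f x))
   \<and> (\<forall>\<tau>\<^sub>0 \<tau>\<^sub>1 \<tau>\<^sub>3. \<exists>v\<^sub>2 :: complex poly. degree v\<^sub>2 \<le> 2 \<and>
        W2_op q a b c \<tau>\<^sub>0 \<tau>\<^sub>1 \<tau>\<^sub>3 \<doteq>
          (\<lambda>f x. \<tau>\<^sub>1 * (1 - inverse (q\<^sup>2)) * (x - c * q) * (x - a * q) / x * T_minus q f x
                 + inverse x * poly v\<^sub>2 x * f x))
   \<and> (q\<^sup>2 \<noteq> 1 \<and> a \<noteq> 0 \<and> b \<noteq> 0 \<and> c \<noteq> 0 \<longrightarrow>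
       (\<exists>\<tau>\<^sub>0 \<tau>\<^sub>1 \<tau>\<^sub>3 \<tau>\<^sub>0' \<tau>\<^sub>1' \<tau>\<^sub>3' \<alpha> \<beta> \<omega>\<^sub>1 \<omega>\<^sub>2 \<omega>\<^sub>3.
          \<tau>\<^sub>1 \<noteq> 0 \<and> \<tau>\<^sub>1' \<noteq> 0 \<and> \<alpha> \<noteq> 0 \<and>
          (let Y' = affine_op \<alpha> \<beta> (Y_op q a b c);
               W\<^sub>1 = W1_op q a b c \<tau>\<^sub>0 \<tau>\<^sub>1 \<tau>\<^sub>3;
               W\<^sub>2 = W2_op q a b c \<tau>\<^sub>0' \<tau>\<^sub>1' \<tau>\<^sub>3'
           in q_commutator q Y' W\<^sub>1 \<doteq> affine_op 1 \<omega>\<^sub>1 W\<^sub>2 \<and>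
              q_commutator q W\<^sub>1 W\<^sub>2 \<doteq> affine_op 1 \<omega>\<^sub>2 Y' \<and>
              q_commutator q W\<^sub>2 Y' \<doteq> affine_op 1 \<omega>\<^sub>3 W\<^sub>1 \<and>
              askey_wilson_triple q Y' W\<^sub>1 W\<^sub>2)))"
proof (intro conjI impI)
  show "\<forall>\<tau>\<^sub>0 \<tau>\<^sub>1 \<tau>\<^sub>3. \<exists>v\<^sub>1. degree v\<^sub>1 \<le> 2 \<and> W1_op q a b c \<tau>\<^sub>0 \<tau>\<^sub>1 \<tau>\<^sub>3 \<doteq>
      (\<lambda>f x. \<tau>\<^sub>1 * a * q * (1 - q\<^sup>2) * (x - 1) * (b * x - c) / x * T_plus q f x
             + inverse x * poly v\<^sub>1 x * f x)"
    using W1_op_normal_form[OF assms] degree_W_mult_poly by blast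
  show "\<forall>\<tau>\<^sub>0 \<tau>\<^sub>1 \<tau>\<^sub>3. \<exists>v\<^sub>2. degree v\<^sub>2 \<le> 2 \<and> W2_op q a b c \<tau>\<^sub>0 \<tau>\<^sub>1 \<tau>\<^sub>3 \<doteq>
      (\<lambda>f x. \<tau>\<^sub>1 * (1 - inverse (q\<^sup>2)) * (x - c * q) * (x - a * q) / x * T_minus q f x
             + inverse x * poly v\<^sub>2 x * f x)"
    using W2_op_normal_form[OF assms] degree_W_mult_poly by blast
next
  assume "q\<^sup>2 \<noteq> 1 \<and> a \<noteq> 0 \<and> b \<noteq> 0 \<and> c \<noteq> 0"
  then have q2: "1 - q\<^sup>2 \<noteq> 0" and nz: "a \<noteq> 0" "b \<noteq> 0" "c \<noteq> 0"
    by auto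
  define p\<^sub>0 p\<^sub>1 p\<^sub>2 where p_defs: "p\<^sub>0 = a * c * q" "p\<^sub>1 = - a * q * (b + c)" "p\<^sub>2 = a * b * q"
  define r\<^sub>0 r\<^sub>1 where r_defs: "r\<^sub>0 = a * c * q\<^sup>2" "r\<^sub>1 = - (a + c) * q"
  have p0: "p\<^sub>0 \<noteq> 0" and r0: "r\<^sub>0 = q * p\<^sub>0"
    using nz assms by (simp_all add: p_defs r_defs power2_eq_square)

  \<comment> \<open>The square root makes the first four scalar equations compatible; \<open>m\<close>, \<open>e\<close> and \<open>h\<close> are then
    read off from the equations for \<open>\<alpha>\<close>, \<open>e\<close> and \<open>h\<close> with \<open>k = 1\<close>.\<close>
  define \<alpha> where "\<alpha> = 1 / ((1 - q\<^sup>2) * csqrt (a * b))"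
  define m where "m = - \<alpha> / (p\<^sub>0 * (1 - q\<^sup>2))"
  define e where "e = \<alpha> * m * p\<^sub>2 * (1 - q\<^sup>2)"
  define h where "h = \<alpha> * p\<^sub>2 * (inverse q - q)"
  have "\<alpha>\<^sup>2 * ((1 - q\<^sup>2)\<^sup>2 * (a * b)) = 1"
    using q2 nz by (simp add: \<alpha>_def power_divide power_mult_distrib)
  moreover have "p\<^sub>2 * (inverse q - q) = (1 - q\<^sup>2) * (a * b)"
    using assms by (simp add: p_defs field_simps power2_eq_square)
  ultimately have key: "\<alpha> * \<alpha> * p\<^sub>2 * (inverse q - q) * (1 - q\<^sup>2) = 1"
    by (simp add: power2_eq_square mult_ac)
  have \<alpha>: "\<alpha> \<noteq> 0"
    using key by auto
  have m: "m \<noteq> 0"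
    using \<alpha> p0 q2 by (simp add: m_def)
  have eq_m: "\<alpha> * e * (inverse q - q) = m"
  proof -
    have "\<alpha> * e * (inverse q - q) = m * (\<alpha> * \<alpha> * p\<^sub>2 * (inverse q - q) * (1 - q\<^sup>2))"
      by (simp add: e_def mult_ac)
    then show ?thesis
      by (simp only: key mult_1_right)
  qed
  have eq_h: "\<alpha> * 1 * p\<^sub>2 * 1 * (inverse q - q) = h"
    by (simp add: h_def)
  have eq_k: "\<alpha> * h * (1 - q\<^sup>2) = 1"
    using key by (simp add: h_def mult_ac)
  have eq_e: "\<alpha> * m * p\<^sub>2 * 1 * (1 - q\<^sup>2) = e"
    by (simp add: e_def)
  have eq_eh: "e * h = 1 * m * p\<^sub>2 * 1"
  proof -
    have "e * h = m * p\<^sub>2 * (\<alpha> * h * (1 - q\<^sup>2))"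
      by (simp add: e_def mult_ac)
    then show ?thesis
      by (simp add: eq_k)
  qed
  have eq_\<alpha>: "- 1 * m * p\<^sub>0 * (1 - q\<^sup>2) = \<alpha>"
    using p0 q2 by (simp add: m_def)

  \<comment> \<open>Solving \<open>\<tau>\<^sub>1 (1 - q\<^sup>2) = k = 1\<close> and \<open>\<tau>\<^sub>1' (1 - q\<^sup>-\<^sup>2) = m\<close>; the other parameters are those
    that bring the operators into normal form.\<close>
  let ?s\<^sub>1 = "a * q * (b + c) + (a + c) * q"
  define \<tau>\<^sub>1 where "\<tau>\<^sub>1 = 1 / (1 - q\<^sup>2)"
  define \<tau>\<^sub>1' where "\<tau>\<^sub>1' = m / (1 - inverse (q\<^sup>2))"
  define \<tau>\<^sub>0 where "\<tau>\<^sub>0 = - \<tau>\<^sub>1 * (1 - q) * ?s\<^sub>1"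
  define \<tau>\<^sub>0' where "\<tau>\<^sub>0' = - \<tau>\<^sub>1' * (1 - inverse q) * ?s\<^sub>1"
  define \<tau>\<^sub>3 where "\<tau>\<^sub>3 = e + \<tau>\<^sub>1 * (1 - q) * (a * b * q + 1)"
  define \<tau>\<^sub>3' where "\<tau>\<^sub>3' = h + \<tau>\<^sub>1' * (1 - inverse q) * (a * b * q + 1)"
  define \<beta> where "\<beta> = \<alpha> * (a * b * q + 1)"
  have q2': "1 - inverse (q\<^sup>2) \<noteq> 0"
    using q2 assms by (simp add: field_simps)
  let ?Y = "affine_op \<alpha> \<beta> (Y_op q a b c)"
  let ?W\<^sub>1 = "W1_op q a b c \<tau>\<^sub>0 \<tau>\<^sub>1 \<tau>\<^sub>3"
  let ?W\<^sub>2 = "W2_op q a b c \<tau>\<^sub>0' \<tau>\<^sub>1' \<tau>\<^sub>3'"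
  let ?FY = "Y_form q p\<^sub>0 p\<^sub>1 p\<^sub>2 r\<^sub>0 r\<^sub>1 1 \<alpha>"
  let ?F\<^sub>1 = "W_form q p\<^sub>0 p\<^sub>1 p\<^sub>2 1 e"
  let ?F\<^sub>2 = "W_form (inverse q) r\<^sub>0 r\<^sub>1 1 m h"

  have Y: "?Y \<doteq> ?FY"
    unfolding \<beta>_def p_defs r_defs by (rule affine_Y_op_Y_form[OF assms])
  have "\<tau>\<^sub>1 * (1 - q\<^sup>2) = 1" "\<tau>\<^sub>1' * (1 - inverse (q\<^sup>2)) = m"
    using q2 q2' by (simp_all add: \<tau>\<^sub>1_def \<tau>\<^sub>1'_def)
  then have W1: "?W\<^sub>1 \<doteq> ?F\<^sub>1" and W2: "?W\<^sub>2 \<doteq> ?F\<^sub>2"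
    using W1_op_W_form[OF assms, of a b c \<tau>\<^sub>1 e] W2_op_W_form[OF assms, of a b c \<tau>\<^sub>1' h]
    unfolding \<tau>\<^sub>0_def \<tau>\<^sub>0'_def \<tau>\<^sub>3_def \<tau>\<^sub>3'_def p_defs r_defs by simp_all

  obtain \<omega>\<^sub>1 where "q_commutator q ?FY ?F\<^sub>1 \<doteq> affine_op 1 \<omega>\<^sub>1 ?F\<^sub>2"
    using q_commutator_Y_form_W_form[OF assms r0, of p\<^sub>1 p\<^sub>2 r\<^sub>1 1 \<alpha> 1 e]
    unfolding eq_m eq_h by metis
  then have rel1: "q_commutator q ?Y ?W\<^sub>1 \<doteq> affine_op 1 \<omega>\<^sub>1 ?W\<^sub>2"
    by (rule q_commutator_transfer[OF assms Y W1 W2 is_shift_op_Y_form is_shift_op_W_form(1)])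
  obtain \<omega>\<^sub>2 where "q_commutator q ?F\<^sub>1 ?F\<^sub>2 \<doteq> affine_op 1 \<omega>\<^sub>2 ?FY"
    using q_commutator_W_form_W_form[OF assms r0 eq_eh, of p\<^sub>1 r\<^sub>1]
    unfolding eq_\<alpha> by metis
  then have rel2: "q_commutator q ?W\<^sub>1 ?W\<^sub>2 \<doteq> affine_op 1 \<omega>\<^sub>2 ?Y"
    by (rule q_commutator_transfer[OF assms W1 W2 Y is_shift_op_W_form])
  obtain \<omega>\<^sub>3 where "q_commutator q ?F\<^sub>2 ?FY \<doteq> affine_op 1 \<omega>\<^sub>3 ?F\<^sub>1"
    using q_commutator_W_form_Y_form[OF assms r0, of r\<^sub>1 1 m h p\<^sub>1 p\<^sub>2 \<alpha>]
    unfolding eq_k eq_e by metis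
  then have rel3: "q_commutator q ?W\<^sub>2 ?Y \<doteq> affine_op 1 \<omega>\<^sub>3 ?W\<^sub>1"
    by (rule q_commutator_transfer[OF assms W2 Y W1 is_shift_op_W_form(2) is_shift_op_Y_form])

  have "\<tau>\<^sub>1 \<noteq> 0" "\<tau>\<^sub>1' \<noteq> 0"
    using q2 q2' m by (simp_all add: \<tau>\<^sub>1_def \<tau>\<^sub>1'_def)
  moreover have "askey_wilson_triple q ?Y ?W\<^sub>1 ?W\<^sub>2"
    unfolding askey_wilson_triple_def using rel1 rel2 rel3 by blast
  ultimately show "\<exists>\<tau>\<^sub>0 \<tau>\<^sub>1 \<tau>\<^sub>3 \<tau>\<^sub>0' \<tau>\<^sub>1' \<tau>\<^sub>3' \<alpha> \<beta> \<omega>\<^sub>1 \<omega>\<^sub>2 \<omega>\<^sub>3.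
      \<tau>\<^sub>1 \<noteq> 0 \<and> \<tau>\<^sub>1' \<noteq> 0 \<and> \<alpha> \<noteq> 0 \<and>
      (let Y' = affine_op \<alpha> \<beta> (Y_op q a b c);
           W\<^sub>1 = W1_op q a b c \<tau>\<^sub>0 \<tau>\<^sub>1 \<tau>\<^sub>3;
           W\<^sub>2 = W2_op q a b c \<tau>\<^sub>0' \<tau>\<^sub>1' \<tau>\<^sub>3'
       in q_commutator q Y' W\<^sub>1 \<doteq> affine_op 1 \<omega>\<^sub>1 W\<^sub>2 \<and>
          q_commutator q W\<^sub>1 W\<^sub>2 \<doteq> affine_op 1 \<omega>\<^sub>2 Y' \<and>
          q_commutator q W\<^sub>2 Y' \<doteq> affine_op 1 \<omega>\<^sub>3 W\<^sub>1 \<and>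
          askey_wilson_triple q Y' W\<^sub>1 W\<^sub>2)"
    using \<alpha> rel1 rel2 rel3 unfolding Let_def by blast
qed

end
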